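(* For every $m, s \in \mathbb{Z}$ and every positive integer $n$ there exists an integer $D \geq 2$, not a perfect square, such that $D \equiv m \pmod n$ and every universal quadratic form over $\mathbb{Z}[\sqrt{D}]$ has at least $s$ variables.
   Context: For $\alpha = a + b\sqrt{D} \in \mathbb{Z}[\sqrt{D}]$, its conjugate is $\alpha' = a - b\sqrt{D}$; $\alpha$ is totally positive ($\alpha \succ 0$) if $\alpha > 0$ and $\alpha' > 0$. A quadratic form over $\mathbb{Z}[\sqrt{D}]$ in $r$ variables is $Q(x_1,\dots,x_r) = \sum_{1 \le i \le j \le r} \alpha_{ij} x_i x_j$ with $\alpha_{ij} \in \mathbb{Z}[\sqrt{D}]$, the variables ranging over $\mathbb{Z}[\sqrt{D}]$. It is totally positive if $Q(\gamma_1,\dots,\gamma_r) \succ 0$ for all $(\gamma_1,\dots,\gamma_r) \in \mathbb{Z}[\sqrt{D}]^r \setminus \{0\}$. It is universal if it is totally positive and every totally positive $\alpha \in \mathbb{Z}[\sqrt{D}]$ equals $Q(\gamma_1,\dots,\gamma_r)$ for some $\gamma_i \in \mathbb{Z}[\sqrt{D}]$. *)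

theory Defs
  imports Complex_Main "HOL-Number_Theory.Cong" "HOL-Computational_Algebra.Nth_Powers"
begin

text \<open>
  The ring \<open>\<int>[\<surd>D]\<close> is rendered as a subset of the reals, since \<open>D\<close> is
  a bound variable in the theorem.
\<close>

definition Zsqrt :: "int \<Rightarrow> real set" where
  "Zsqrt D = {of_int a + of_int b * sqrt (of_int D) | a b. True}"

text \<open>
  The conjugate is only meaningful for \<open>\<alpha> \<in> Zsqrt D\<close> with \<open>D \<ge> 0\<close> not a perfect square, when
  the representation \<open>\<alpha> = a + b \<surd>D\<close> is unique; see \<open>conjugate_eq\<close> below.
\<close>

definition conjugate :: "int \<Rightarrow> real \<Rightarrow> real" where
  "conjugate D \<alpha> = (THE \<beta>. \<exists>a b :: int.
     \<alpha> = of_int a + of_int b * sqrt (of_int D) \<and> \<beta> = of_int a - of_int b * sqrt (of_int D))"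

definition totally_positive :: "int \<Rightarrow> real \<Rightarrow> bool" where
  "totally_positive D \<alpha> \<longleftrightarrow> \<alpha> \<in> Zsqrt D \<and> 0 < \<alpha> \<and> 0 < conjugate D \<alpha>"

text \<open>
  A quadratic form in \<open>r\<close> variables is given by its coefficients \<open>A i j\<close> for \<open>i \<le> j < r\<close> (indices
  shifted to start at 0); values of \<open>A\<close> at other indices are irrelevant.  Likewise a
  vector of length \<open>r\<close> is a function of which only the values at indices below \<open>r\<close> matter.
\<close>

definition quadratic_form_over :: "int \<Rightarrow> nat \<Rightarrow> (nat \<Rightarrow> nat \<Rightarrow> real) \<Rightarrow> bool" where
  "quadratic_form_over D r A \<longleftrightarrow> (\<forall>j<r. \<forall>i\<le>j. A i j \<in> Zsqrt D)"

definition form_value :: "nat \<Rightarrow> (nat \<Rightarrow> nat \<Rightarrow> real) \<Rightarrow> (nat \<Rightarrow> real) \<Rightarrow> real" where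
  "form_value r A x = (\<Sum>j<r. \<Sum>i\<le>j. A i j * x i * x j)"

definition totally_positive_form :: "int \<Rightarrow> nat \<Rightarrow> (nat \<Rightarrow> nat \<Rightarrow> real) \<Rightarrow> bool" where
  "totally_positive_form D r A \<longleftrightarrow>
     (\<forall>x. (\<forall>i<r. x i \<in> Zsqrt D) \<and> (\<exists>i<r. x i \<noteq> 0) \<longrightarrow> totally_positive D (form_value r A x))"

definition universal_form :: "int \<Rightarrow> nat \<Rightarrow> (nat \<Rightarrow> nat \<Rightarrow> real) \<Rightarrow> bool" where
  "universal_form D r A \<longleftrightarrow> totally_positive_form D r A \<and>
     (\<forall>\<alpha>. totally_positive D \<alpha> \<longrightarrow> (\<exists>x. (\<forall>i<r. x i \<in> Zsqrt D) \<and> form_value r A x = \<alpha>))"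

lemma Zsqrt_rep_unique:
  fixes D a b c d :: int
  assumes "D \<ge> 0" and nsq: "\<not> is_square D"
    and eq: "of_int a + of_int b * sqrt (of_int D) = (of_int c + of_int d * sqrt (of_int D) :: real)"
  shows "a = c \<and> b = d"
proof -
  have "real_of_int (b - d) * sqrt (of_int D) = of_int (c - a)"
    using eq by (simp add: algebra_simps)
  then have "(real_of_int (b - d) * sqrt (of_int D))\<^sup>2 = (of_int (c - a))\<^sup>2"
    by simp
  then have "real_of_int ((b - d)\<^sup>2 * D) = of_int ((c - a)\<^sup>2)"
    using \<open>D \<ge> 0\<close> by (simp add: power_mult_distrib)
  then have sq: "(b - d)\<^sup>2 * D = (c - a)\<^sup>2"
    by (simp only: of_int_eq_iff)
  have "b = d"
  proof (rule ccontr)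
    assume ne: "b \<noteq> d"
    from sq have "(b - d)\<^sup>2 dvd (c - a)\<^sup>2" by (metis dvd_triv_left)
    then have "b - d dvd c - a" by simp
    then obtain k where "c - a = (b - d) * k" by (elim dvdE)
    with sq ne have "D = k\<^sup>2" by (simp add: power_mult_distrib)
    with nsq show False by (auto simp: is_nth_power_def)
  qed
  with eq show ?thesis by simp
qed

lemma conjugate_eq:
  fixes D a b :: int
  assumes "D \<ge> 0" "\<not> is_square D"
  shows "conjugate D (of_int a + of_int b * sqrt (of_int D)) = of_int a - of_int b * sqrt (of_int D)"
  unfolding conjugate_def
  by (rule the_equality) (use Zsqrt_rep_unique[OF assms] in blast)+

end

theory Submission
  imports Defs
begin

text \<open>
  If vectors \<open>v\<^sub>i\<close> represent \<open>\<alpha>\<^sub>i\<close>, then \<open>\<beta> = B(v\<^sub>i, v\<^sub>j)\<close> satisfies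
  \<open>\<beta>\<^sup>2 \<le> 4\<alpha>\<^sub>i\<alpha>\<^sub>j\<close> in both real embeddings. So it suffices to find \<open>D\<close> with \<open>s\<close> totally positive
  elements for which this forces \<open>\<beta> = 0\<close>: the \<open>v\<^sub>i\<close> are then orthogonal, hence independent.
  If \<open>\<surd>D\<close> has fractions \<open>p\<^sub>i/q\<^sub>i\<close> just above it with \<open>0 < p\<^sub>i - q\<^sub>i\<surd>D < 2/q\<^sub>i\<^sup>3\<close> and quickly growing
  denominators, the elements \<open>p\<^sub>i + q\<^sub>i\<surd>D\<close> have this property. Such approximations only prescribe an
  interval for the fractional part of \<open>\<surd>D\<close>, and the numbers \<open>\<surd>D\<close> with \<open>D \<equiv> m (mod n)\<close> are dense
  modulo 1.
\<close>

section \<open>Arithmetic and conjugation in Z[sqrt D]\<close>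

lemma Zsqrt_memI: "of_int a + of_int b * sqrt (of_int D) \<in> Zsqrt D"
  by (auto simp: Zsqrt_def)

lemma Zsqrt_memE:
  assumes "x \<in> Zsqrt D"
  obtains a b where "x = of_int a + of_int b * sqrt (of_int D)"
  using assms by (auto simp: Zsqrt_def)

lemma Zsqrt_of_int: "of_int a \<in> Zsqrt D"
  using Zsqrt_memI[of a 0] by simp

lemma Zsqrt_add:
  assumes "x \<in> Zsqrt D" "y \<in> Zsqrt D"
  shows "x + y \<in> Zsqrt D"
proof -
  obtain a b c d where "x = of_int a + of_int b * sqrt (of_int D)"
    "y = of_int c + of_int d * sqrt (of_int D)"
    using assms by (metis Zsqrt_memE)
  then have "x + y = of_int (a + c) + of_int (b + d) * sqrt (of_int D)"
    by (simp add: algebra_simps)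
  then show ?thesis
    by (metis Zsqrt_memI)
qed

lemma Zsqrt_sum: "(\<And>i. i \<in> I \<Longrightarrow> f i \<in> Zsqrt D) \<Longrightarrow> sum f I \<in> Zsqrt D"
  by (induction I rule: infinite_finite_induct)
    (use Zsqrt_of_int[of 0] in \<open>auto intro: Zsqrt_add\<close>)

lemma Zsqrt_mult_rep:
  fixes a b c d D :: int
  assumes "D \<ge> 0"
  shows "(of_int a + of_int b * sqrt (of_int D)) * (of_int c + of_int d * sqrt (of_int D)) =
    (of_int (a * c + b * d * D) + of_int (a * d + b * c) * sqrt (of_int D) :: real)"
proof -
  have "of_int b * of_int d * (sqrt (of_int D) * sqrt (of_int D)) = (of_int (b * d * D) :: real)"
    using assms by simp
  then show ?thesis
    by (simp add: algebra_simps)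
qed

lemma Zsqrt_mult:
  assumes "D \<ge> 0" "x \<in> Zsqrt D" "y \<in> Zsqrt D"
  shows "x * y \<in> Zsqrt D"
  using assms by (metis Zsqrt_memE Zsqrt_memI Zsqrt_mult_rep)

lemma conjugate_of_int:
  assumes "D \<ge> 0" "\<not> is_square D"
  shows "conjugate D (of_int a) = of_int a"
  using conjugate_eq[OF assms, of a 0] by simp

lemma conjugate_add:
  assumes "D \<ge> 0" "\<not> is_square D" "x \<in> Zsqrt D" "y \<in> Zsqrt D"
  shows "conjugate D (x + y) = conjugate D x + conjugate D y"
proof -
  obtain a b c d where xy: "x = of_int a + of_int b * sqrt (of_int D)"
    "y = of_int c + of_int d * sqrt (of_int D)"
    using assms(3,4) by (metis Zsqrt_memE)
  then have sum: "x + y = of_int (a + c) + of_int (b + d) * sqrt (of_int D)"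
    by (simp add: algebra_simps)
  show ?thesis
    unfolding sum conjugate_eq[OF assms(1,2)] by (simp add: xy conjugate_eq[OF assms(1,2)] algebra_simps)
qed

text \<open>Negating \<open>b\<close> and \<open>d\<close> in the product rule keeps the rational
  part and negates the coefficient of sqrt D.\<close>

lemma conjugate_mult:
  assumes "D \<ge> 0" "\<not> is_square D" "x \<in> Zsqrt D" "y \<in> Zsqrt D"
  shows "conjugate D (x * y) = conjugate D x * conjugate D y"
proof -
  obtain a b c d where xy: "x = of_int a + of_int b * sqrt (of_int D)"
    "y = of_int c + of_int d * sqrt (of_int D)"
    using assms(3,4) by (metis Zsqrt_memE)
  have "conjugate D (x * y) = of_int (a * c + b * d * D) - of_int (a * d + b * c) * sqrt (of_int D)"
    unfolding xy Zsqrt_mult_rep[OF assms(1)] by (rule conjugate_eq[OF assms(1,2)])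
  also have "\<dots> = (of_int a + of_int (- b) * sqrt (of_int D)) * (of_int c + of_int (- d) * sqrt (of_int D))"
    unfolding Zsqrt_mult_rep[OF assms(1)] by (simp add: algebra_simps)
  also have "\<dots> = conjugate D x * conjugate D y"
    unfolding xy conjugate_eq[OF assms(1,2)] by simp
  finally show ?thesis .
qed

section \<open>The polar form and its Cauchy-Schwarz inequality\<close>

text \<open>This is Q(x + y) - Q(x) - Q(y). It is not halved, so that it takes values in Z[sqrt D]
  at vectors over Z[sqrt D].\<close>

definition polar_form :: "nat \<Rightarrow> (nat \<Rightarrow> nat \<Rightarrow> real) \<Rightarrow> (nat \<Rightarrow> real) \<Rightarrow> (nat \<Rightarrow> real) \<Rightarrow> real" where
  "polar_form r A x y = (\<Sum>j<r. \<Sum>i\<le>j. A i j * (x i * y j + y i * x j))"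

lemma polar_form_self: "polar_form r A x x = 2 * form_value r A x"
  by (simp add: polar_form_def form_value_def sum_distrib_left algebra_simps)

lemma form_value_lincomb:
  "form_value r A (\<lambda>k. a * x k + b * y k) =
    a\<^sup>2 * form_value r A x + a * b * polar_form r A x y + b\<^sup>2 * form_value r A y"
  by (simp add: polar_form_def form_value_def sum_distrib_left sum.distrib[symmetric]
      algebra_simps power2_eq_square)

lemma polar_form_sum_left:
  "polar_form r A (\<lambda>k. \<Sum>l\<in>I. c l * x l k) y = (\<Sum>l\<in>I. c l * polar_form r A (x l) y)"
proof -
  have "polar_form r A (\<lambda>k. \<Sum>l\<in>I. c l * x l k) y =
    (\<Sum>j<r. \<Sum>i\<le>j. \<Sum>l\<in>I. c l * (A i j * (x l i * y j + y i * x l j)))"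
    unfolding polar_form_def
    by (intro sum.cong refl)
      (simp add: sum_distrib_left sum_distrib_right sum.distrib[symmetric] algebra_simps)
  also have "\<dots> = (\<Sum>j<r. \<Sum>l\<in>I. \<Sum>i\<le>j. c l * (A i j * (x l i * y j + y i * x l j)))"
    by (intro sum.cong refl sum.swap)
  also have "\<dots> = (\<Sum>l\<in>I. \<Sum>j<r. \<Sum>i\<le>j. c l * (A i j * (x l i * y j + y i * x l j)))"
    by (rule sum.swap)
  finally show ?thesis
    by (simp add: polar_form_def sum_distrib_left)
qed

lemma polar_form_zero_left: "(\<And>k. k < r \<Longrightarrow> x k = 0) \<Longrightarrow> polar_form r A x y = 0"
  unfolding polar_form_def by (intro sum.neutral ballI) simp

lemma form_value_zero: "(\<And>k. k < r \<Longrightarrow> x k = 0) \<Longrightarrow> form_value r A x = 0"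
  unfolding form_value_def by (intro sum.neutral ballI) simp

lemma polar_form_in_Zsqrt:
  assumes "D \<ge> 0" "quadratic_form_over D r A"
    and "\<And>i. i < r \<Longrightarrow> x i \<in> Zsqrt D" "\<And>i. i < r \<Longrightarrow> y i \<in> Zsqrt D"
  shows "polar_form r A x y \<in> Zsqrt D"
  unfolding polar_form_def using assms
  by (intro Zsqrt_sum Zsqrt_mult Zsqrt_add) (auto simp: quadratic_form_over_def)

text \<open>Positivity is available only at vectors over Z[sqrt D], so the discriminant argument is
  run at one such vector \<open>w\<close>, with denominators cleared. The signs of its value and of
  the conjugate of that value give the two inequalities.\<close>

lemma polar_form_bound:
  assumes D: "D \<ge> 0" "\<not> is_square D"
    and A: "quadratic_form_over D r A" "totally_positive_form D r A"
    and x: "\<And>i. i < r \<Longrightarrow> x i \<in> Zsqrt D" and y: "\<And>i. i < r \<Longrightarrow> y i \<in> Zsqrt D"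
    and \<alpha>: "totally_positive D \<alpha>" "form_value r A x = \<alpha>"
    and \<gamma>: "\<gamma> \<in> Zsqrt D" "form_value r A y = \<gamma>"
  defines "\<beta> \<equiv> polar_form r A x y"
  shows "\<beta>\<^sup>2 \<le> 4 * \<alpha> * \<gamma>"
    and "(conjugate D \<beta>)\<^sup>2 \<le> 4 * conjugate D \<alpha> * conjugate D \<gamma>"
proof -
  have \<alpha>Z: "\<alpha> \<in> Zsqrt D"
    using \<alpha> by (simp add: totally_positive_def)
  have \<beta>Z: "\<beta> \<in> Zsqrt D"
    unfolding \<beta>_def by (rule polar_form_in_Zsqrt) (use D A x y in auto)
  \<comment> \<open>The integers 2, -1 and 4 get names as elements of Z[sqrt D], so that conjugation
    distributes over them as over any other factor.\<close>
  define two where "two = (of_int 2 :: real)"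
  define mone where "mone = (of_int (-1) :: real)"
  define four where "four = (of_int 4 :: real)"
  have vals: "two \<in> Zsqrt D" "mone \<in> Zsqrt D" "four \<in> Zsqrt D"
    unfolding two_def mone_def four_def by (rule Zsqrt_of_int)+
  have cvals: "conjugate D two = 2" "conjugate D mone = -1" "conjugate D four = 4"
    unfolding two_def mone_def four_def conjugate_of_int[OF D] by simp_all
  text \<open>This is \<open>2\<alpha>(t x + y)\<close> for the minimiser \<open>t = -\<beta>/(2\<alpha>)\<close> of \<open>Q(t x + y)\<close>.\<close>
  define w where "w = (\<lambda>k. (mone * \<beta>) * x k + (two * \<alpha>) * y k)"
  have w: "w i \<in> Zsqrt D" if "i < r" for i
    unfolding w_def using that D x y \<alpha>Z \<beta>Z vals by (intro Zsqrt_add Zsqrt_mult) auto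
  have val: "form_value r A w = \<alpha> * (four * (\<alpha> * \<gamma>) + mone * (\<beta> * \<beta>))"
    unfolding w_def form_value_lincomb \<alpha>(2) \<gamma>(2) \<beta>_def[symmetric]
    by (simp add: two_def mone_def four_def algebra_simps power2_eq_square)
  have cval: "conjugate D (form_value r A w) = conjugate D \<alpha> *
      (4 * conjugate D \<alpha> * conjugate D \<gamma> - (conjugate D \<beta>)\<^sup>2)"
    unfolding val using D vals cvals \<alpha>Z \<beta>Z \<gamma>(1)
    by (simp add: conjugate_mult conjugate_add Zsqrt_mult Zsqrt_add power2_eq_square)
  have nonneg: "form_value r A w \<ge> 0 \<and> conjugate D (form_value r A w) \<ge> 0"
  \<comment> \<open>If \<open>w\<close> vanishes, total positivity says nothing, but the value is
    then 0, which the nonstrict inequalities allow.\<close>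
  proof (cases "\<exists>i<r. w i \<noteq> 0")
    case True
    then have "totally_positive D (form_value r A w)"
      using A(2) w unfolding totally_positive_form_def by blast
    then show ?thesis
      by (simp add: totally_positive_def)
  next
    case False
    then have "form_value r A w = 0"
      by (intro form_value_zero) auto
    then show ?thesis
      using conjugate_of_int[OF D, of 0] by simp
  qed
  have pos: "\<alpha> > 0" "conjugate D \<alpha> > 0"
    using \<alpha> by (simp_all add: totally_positive_def)
  show "\<beta>\<^sup>2 \<le> 4 * \<alpha> * \<gamma>"
    using nonneg pos(1) unfolding val
    by (simp add: zero_le_mult_iff four_def mone_def power2_eq_square)
  show "(conjugate D \<beta>)\<^sup>2 \<le> 4 * conjugate D \<alpha> * conjugate D \<gamma>"
    using nonneg pos(2) unfolding cval by (simp add: zero_le_mult_iff)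
qed

section \<open>Orthogonality and the number of variables\<close>

text \<open>Gaussian elimination, by induction on the number of equations. A pivot \<open>p\<close>
  in the last equation is eliminated from the others at the cost of one unknown; without a pivot
  that equation holds trivially.\<close>

lemma underdetermined_system_has_solution:
  fixes v :: "'b \<Rightarrow> nat \<Rightarrow> 'a::field"
  assumes "finite I" "r < card I"
  shows "\<exists>c. (\<exists>i\<in>I. c i \<noteq> 0) \<and> (\<forall>k<r. (\<Sum>i\<in>I. c i * v i k) = 0)"
  using assms
proof (induction r arbitrary: I v)
  case 0
  then have "I \<noteq> {}"
    by auto
  then show ?case
    by (intro exI[of _ "\<lambda>_. 1"]) auto
next
  case (Suc r)
  show ?case
  proof (cases "\<exists>p\<in>I. v p r \<noteq> 0")
    case False
    have "r < card I"
      using Suc.prems by simp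
    then obtain c where c: "\<exists>i\<in>I. c i \<noteq> 0" "\<forall>k<r. (\<Sum>i\<in>I. c i * v i k) = 0"
      using Suc.IH[OF Suc.prems(1), of v] by blast
    have "(\<Sum>i\<in>I. c i * v i r) = 0"
      using False by (intro sum.neutral) auto
    with c show ?thesis
      by (intro exI[of _ c]) (auto simp: less_Suc_eq)
  next
    case True
    then obtain p where p: "p \<in> I" "v p r \<noteq> 0"
      by blast
    define J where "J = I - {p}"
    have J: "finite J" "r < card J" "p \<notin> J" "I = insert p J"
      using Suc.prems p unfolding J_def by auto
    obtain c where c: "\<exists>i\<in>J. c i \<noteq> 0"
      "\<forall>k<r. (\<Sum>i\<in>J. c i * (v i k - v i r / v p r * v p k)) = 0"
      using Suc.IH[OF J(1,2), of "\<lambda>i k. v i k - v i r / v p r * v p k"] by blast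
    \<comment> \<open>The value at the pivot is the one that solves the last equation.\<close>
    define d where "d = c(p := - (\<Sum>i\<in>J. c i * v i r) / v p r)"
    have d_sum: "(\<Sum>i\<in>I. d i * v i k) = (\<Sum>i\<in>J. c i * (v i k - v i r / v p r * v p k))" for k
    proof -
      have "(\<Sum>i\<in>J. d i * v i k) = (\<Sum>i\<in>J. c i * v i k)"
        using J(3) by (intro sum.cong) (auto simp: d_def)
      then have "(\<Sum>i\<in>I. d i * v i k) =
          - (\<Sum>i\<in>J. c i * v i r) / v p r * v p k + (\<Sum>i\<in>J. c i * v i k)"
        using J by (simp add: d_def)
      also have "\<dots> = (\<Sum>i\<in>J. c i * (v i k - v i r / v p r * v p k))"
        by (simp add: sum_distrib_left sum_distrib_right sum_divide_distrib sum_subtractf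
            algebra_simps)
      finally show ?thesis .
    qed
    have "(\<Sum>i\<in>I. d i * v i r) = 0"
      unfolding d_sum using p(2) by simp
    moreover have "\<forall>k<r. (\<Sum>i\<in>I. d i * v i k) = 0"
      unfolding d_sum using c(2) .
    moreover have "\<exists>i\<in>I. d i \<noteq> 0"
      using c(1) J(3,4) unfolding d_def by auto
    ultimately show ?thesis
      by (intro exI[of _ d]) (auto simp: less_Suc_eq)
  qed
qed

text \<open>Vectors representing the \<open>\<alpha> i\<close> are pairwise orthogonal by
  \<open>sep\<close>, and the form is positive on each of them, so they are linearly independent in
  a space of dimension \<open>r\<close>.\<close>

lemma universal_form_rank_ge:
  assumes D: "D \<ge> 0" "\<not> is_square D"
    and A: "quadratic_form_over D r A" "universal_form D r A"
    and \<alpha>: "\<And>i. i < s \<Longrightarrow> totally_positive D (\<alpha> i)"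
    and sep: "\<And>i j \<beta>. i < j \<Longrightarrow> j < s \<Longrightarrow> \<beta> \<in> Zsqrt D \<Longrightarrow> \<beta>\<^sup>2 \<le> 4 * \<alpha> i * \<alpha> j \<Longrightarrow>
      (conjugate D \<beta>)\<^sup>2 \<le> 4 * conjugate D (\<alpha> i) * conjugate D (\<alpha> j) \<Longrightarrow> \<beta> = 0"
  shows "s \<le> r"
proof (rule ccontr)
  assume "\<not> s \<le> r"
  have "\<forall>i<s. \<exists>x. (\<forall>k<r. x k \<in> Zsqrt D) \<and> form_value r A x = \<alpha> i"
    using A(2) \<alpha> unfolding universal_form_def by blast
  then obtain v where v: "\<And>i k. i < s \<Longrightarrow> k < r \<Longrightarrow> v i k \<in> Zsqrt D"
    and val: "\<And>i. i < s \<Longrightarrow> form_value r A (v i) = \<alpha> i"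
    by metis
  have tpf: "totally_positive_form D r A"
    using A(2) by (simp add: universal_form_def)
  have orth: "polar_form r A (v i) (v j) = 0" if "i < j" "j < s" for i j
  proof (rule sep[OF that])
    have i: "i < s"
      using that by simp
    show "polar_form r A (v i) (v j) \<in> Zsqrt D"
      by (rule polar_form_in_Zsqrt[OF D(1) A(1) v[OF i] v[OF that(2)]])
    have Z: "\<alpha> j \<in> Zsqrt D"
      using \<alpha>[OF that(2)] by (simp add: totally_positive_def)
    note b = polar_form_bound[OF D A(1) tpf v[OF i] v[OF that(2)] \<alpha>[OF i] val[OF i] Z val[OF that(2)]]
    show "(polar_form r A (v i) (v j))\<^sup>2 \<le> 4 * \<alpha> i * \<alpha> j"
      by (rule b)
    show "(conjugate D (polar_form r A (v i) (v j)))\<^sup>2 \<le> 4 * conjugate D (\<alpha> i) * conjugate D (\<alpha> j)"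
      by (rule b)
  qed
  have sym: "polar_form r A x y = polar_form r A y x" for x y
    by (simp add: polar_form_def add.commute)
  \<comment> \<open>The coefficients may be arbitrary reals, since the polar form is linear over the
    reals.\<close>
  obtain c where c: "\<exists>i\<in>{..<s}. c i \<noteq> 0" "\<forall>k<r. (\<Sum>i\<in>{..<s}. c i * v i k) = 0"
    using underdetermined_system_has_solution[of "{..<s}" r v] \<open>\<not> s \<le> r\<close> by auto
  then obtain j where j: "j < s" "c j \<noteq> 0"
    by auto
  \<comment> \<open>Pairing the relation with \<open>v j\<close> kills every term except the one at
    \<open>j\<close>.\<close>
  have "0 = polar_form r A (\<lambda>k. \<Sum>i<s. c i * v i k) (v j)"
    using c(2) by (intro polar_form_zero_left[symmetric]) auto
  also have "\<dots> = (\<Sum>i<s. c i * polar_form r A (v i) (v j))"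
    by (rule polar_form_sum_left)
  also have "\<dots> = (\<Sum>i<s. if i = j then c j * (2 * \<alpha> j) else 0)"
    using orth sym j(1)
    by (intro sum.cong refl) (metis lessThan_iff linorder_neqE_nat mult_zero_right polar_form_self val)
  also have "\<dots> = c j * (2 * \<alpha> j)"
    using j(1) by simp
  finally show False
    using j \<alpha>[OF j(1)] by (simp add: totally_positive_def)
qed

section \<open>Separation of good approximants\<close>

text \<open>The two bounds force |b| < q and put \<open>b * \<theta>\<close> so close to
  \<open>a\<close> that the integer \<open>q * a - b * p\<close> is below 1 in absolute value, hence
  0. Coprimality then makes \<open>q\<close> divide \<open>b\<close>, so
  \<open>b = 0\<close>.\<close>

lemma approximants_separated:
  fixes a b p q p\<^sub>0 q\<^sub>0 :: int and \<theta> :: real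
  assumes \<theta>: "\<theta> \<ge> 1"
    and q: "q\<^sub>0 \<ge> 64" "q \<ge> 144 * q\<^sub>0" "coprime p q"
    and ap\<^sub>0: "0 < p\<^sub>0 - q\<^sub>0 * \<theta>" "p\<^sub>0 - q\<^sub>0 * \<theta> < 2 / real_of_int q\<^sub>0 ^ 3"
    and ap: "0 < p - q * \<theta>" "p - q * \<theta> < 2 / real_of_int q ^ 3"
    and \<beta>: "(a + b * \<theta>)\<^sup>2 \<le> 4 * (p\<^sub>0 + q\<^sub>0 * \<theta>) * (p + q * \<theta>)"
    and \<beta>': "(a - b * \<theta>)\<^sup>2 \<le> 4 * (p\<^sub>0 - q\<^sub>0 * \<theta>) * (p - q * \<theta>)"
  shows "a = 0 \<and> b = 0"
proof -
  have q0r: "real_of_int q\<^sub>0 \<ge> 64" and qr: "real_of_int q \<ge> 144 * real_of_int q\<^sub>0"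
    using q by linarith+
  have cube: "2 / real_of_int x ^ 3 \<le> 1 / (8 * (real_of_int x)\<^sup>2)" if "real_of_int x \<ge> 64" for x
  proof -
    have "2 / real_of_int x ^ 3 = (2 / x) * (1 / (real_of_int x)\<^sup>2)"
      by (simp add: power3_eq_cube power2_eq_square)
    also have "\<dots> \<le> (1 / 8) * (1 / (real_of_int x)\<^sup>2)"
      using that by (intro mult_right_mono) (auto simp: field_simps)
    finally show ?thesis
      by simp
  qed
  have small: "1 / (8 * (real_of_int x)\<^sup>2) \<le> 1 / 8" if "real_of_int x \<ge> 64" for x
    using that by (simp add: field_simps one_le_power)
  have e0: "p\<^sub>0 - q\<^sub>0 * \<theta> < 1 / 8"
    using ap\<^sub>0(2) cube[OF q0r] small[OF q0r] by linarith
  have q64: "real_of_int q \<ge> 64"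
    using q0r qr by linarith
  have e: "p - q * \<theta> < 1 / (8 * (real_of_int q)\<^sup>2)" "p - q * \<theta> < 1 / 8"
    using ap(2) cube[OF q64] small[OF q64] by linarith+
  have "q\<^sub>0 * \<theta> \<ge> 1" "q * \<theta> \<ge> 1"
    using \<theta> q0r q64 mult_mono[of 1 "real_of_int q\<^sub>0" 1 \<theta>] mult_mono[of 1 "real_of_int q" 1 \<theta>]
    by auto
  then have "p\<^sub>0 + q\<^sub>0 * \<theta> \<le> 3 * (q\<^sub>0 * \<theta>)" "p + q * \<theta> \<le> 3 * (q * \<theta>)" "p + q * \<theta> \<ge> 0"
    using e0 e ap by linarith+
  then have "(p\<^sub>0 + q\<^sub>0 * \<theta>) * (p + q * \<theta>) \<le> (3 * (q\<^sub>0 * \<theta>)) * (3 * (q * \<theta>))"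
    using \<open>q\<^sub>0 * \<theta> \<ge> 1\<close> by (intro mult_mono) auto
  \<comment> \<open>The factor 144 is used here: 4 * 3 * 3 / 144 = 1/4 turns the bound into the
    square of \<open>q * \<theta> / 2\<close>.\<close>
  also have "\<dots> \<le> (3 * (q / 144 * \<theta>)) * (3 * (q * \<theta>))"
    using qr \<theta> q64 by (intro mult_mono mult_left_mono mult_right_mono) auto
  finally have "(a + b * \<theta>)\<^sup>2 \<le> (q * \<theta> / 2)\<^sup>2"
    using \<beta> by (simp add: power2_eq_square algebra_simps)
  then have B: "\<bar>a + b * \<theta>\<bar> \<le> q * \<theta> / 2"
    using \<open>q * \<theta> \<ge> 1\<close> abs_le_square_iff[of "a + b * \<theta>" "q * \<theta> / 2"] by simp
  \<comment> \<open>Only the second error is bounded in terms of \<open>q\<close>; with the factor 4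
    the product stays below 1 / (16 q^2), so \<open>a - b * \<theta>\<close> is of order
    1/q.\<close>
  have "(p\<^sub>0 - q\<^sub>0 * \<theta>) * (p - q * \<theta>) < (1 / 8) * (1 / (8 * (real_of_int q)\<^sup>2))"
    using e0 e ap ap\<^sub>0 by (intro mult_strict_mono) auto
  then have "(a - b * \<theta>)\<^sup>2 < (1 / (2 * q))\<^sup>2 / 4"
    using \<beta>' by (simp add: power2_eq_square algebra_simps)
  also have "\<dots> \<le> (1 / (2 * q))\<^sup>2"
    by simp
  finally have B': "\<bar>a - b * \<theta>\<bar> < 1 / (2 * q)"
    using q64 power2_less_imp_less[of "\<bar>a - b * \<theta>\<bar>" "1 / (2 * q)"] by simp
  have half: "1 / (2 * real_of_int q) \<le> 1 / 2"
    using q64 by (simp add: field_simps)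
  \<comment> \<open>The left side is the difference of \<open>a + b * \<theta>\<close> and
    \<open>a - b * \<theta>\<close>.\<close>
  have "\<bar>2 * (b * \<theta>)\<bar> < 2 * (q * \<theta>)"
    using B B' half \<open>q * \<theta> \<ge> 1\<close> by linarith
  then have "\<bar>real_of_int b\<bar> * \<theta> < q * \<theta>"
    using \<theta> by (simp add: abs_mult)
  then have bq: "\<bar>real_of_int b\<bar> < q"
    using \<theta> by (simp add: mult_less_cancel_right)
  \<comment> \<open>In terms of the two errors the contributions of \<open>q * b * \<theta>\<close>
    cancel.\<close>
  have "real_of_int \<bar>q * a - b * p\<bar> = \<bar>q * (a - b * \<theta>) - b * (p - q * \<theta>)\<bar>"
    by (simp add: algebra_simps)
  also have "\<dots> \<le> q * \<bar>a - b * \<theta>\<bar> + \<bar>real_of_int b\<bar> * (p - q * \<theta>)"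
    using abs_triangle_ineq4[of "q * (a - b * \<theta>)" "b * (p - q * \<theta>)"] q64 ap
    by (simp add: abs_mult)
  also have "\<dots> < 1 / 2 + 1 / 2"
  proof (intro add_less_le_mono)
    show "q * \<bar>a - b * \<theta>\<bar> < 1 / 2"
      using B' q64 by (simp add: field_simps)
    have "\<bar>real_of_int b\<bar> * (p - q * \<theta>) \<le> q * (1 / (8 * (real_of_int q)\<^sup>2))"
      using bq e ap by (intro mult_mono) auto
    also have "\<dots> \<le> 1 / 2"
      using q64 by (simp add: power2_eq_square field_simps)
    finally show "\<bar>real_of_int b\<bar> * (p - q * \<theta>) \<le> 1 / 2" .
  qed
  finally have "\<bar>q * a - b * p\<bar> < 1"
    by linarith
  then have eq: "b * p = q * a"
    by linarith
  then have "q dvd b"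
    using q(3) coprime_dvd_mult_left_iff[of q p b] by (simp add: coprime_commute)
  moreover have "\<bar>b\<bar> < q"
    using bq by linarith
  ultimately have "b = 0"
    using dvd_imp_le_int[of b q] by linarith
  then show ?thesis
    using eq q by auto
qed

section \<open>Fractions from a lacunary series\<close>

text \<open>Each denominator is the fourth power of the one before, so lowering a fraction by
  \<open>1 / denom i ^ 4\<close> leads to the denominator \<open>denom (Suc i)\<close>.\<close>

definition denom :: "nat \<Rightarrow> int" where
  "denom i = 64 ^ (4 ^ i)"

text \<open>The fractions \<open>numer i / denom i\<close> are the partial sums of 1/64 - 64^(-4) -
  64^(-16) - ..., a series of Liouville type.\<close>

fun numer :: "nat \<Rightarrow> int" where
  "numer 0 = 1"
| "numer (Suc i) = numer i * denom i ^ 3 - 1"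

lemma denom_Suc: "denom (Suc i) = denom i ^ 4"
  by (simp add: denom_def power_mult[symmetric] mult.commute)

lemma denom_ge: "denom i \<ge> 64"
  using power_increasing[of 1 "4 ^ i" "64::int"] by (simp add: denom_def)

lemma denom_gap:
  assumes "i < j"
  shows "denom j \<ge> 144 * denom i"
proof -
  have "144 * denom i \<le> denom i ^ 3 * denom i"
    using denom_ge[of i] power_mono[of 64 "denom i" 3] by (intro mult_right_mono) auto
  also have "\<dots> = denom (Suc i)"
    by (simp add: denom_Suc power_Suc2[symmetric])
  also have "\<dots> \<le> denom j"
    unfolding denom_def using assms by (intro power_increasing) auto
  finally show ?thesis .
qed

text \<open>Modulo \<open>denom k\<close> the next numerator is -1, and the next denominator is a
  power of \<open>denom k\<close>.\<close>

lemma coprime_numer_denom: "coprime (numer i) (denom i)"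
proof (cases i)
  case (Suc k)
  have "coprime (numer k * denom k ^ 3 - 1) (denom k)"
  proof (rule coprimeI)
    fix c assume c: "c dvd numer k * denom k ^ 3 - 1" "c dvd denom k"
    then have "c dvd numer k * denom k ^ 3"
      by (simp add: power3_eq_cube)
    from dvd_diff[OF this c(1)] show "is_unit c"
      by simp
  qed
  then show ?thesis
    by (simp add: Suc denom_Suc)
qed simp

text \<open>
  The errors \<open>x\<^sub>i = numer i - denom i * \<xi>\<close> satisfy \<open>x\<^sub>i\<^sub>+\<^sub>1 = (denom i)\<^sup>3 x\<^sub>i - 1\<close>, so a bound
  on the last one propagates to all earlier ones.
\<close>

lemma approximation_descends:
  fixes \<xi> :: real
  assumes "0 < numer s - denom s * \<xi>" "numer s - denom s * \<xi> < 2 / real_of_int (denom s) ^ 3" "i \<le> s"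
  shows "0 < numer i - denom i * \<xi> \<and> numer i - denom i * \<xi> < 2 / real_of_int (denom i) ^ 3"
  using assms(3)
proof (induction rule: inc_induct)
  case base
  then show ?case
    using assms by simp
next
  case (step i)
  define y where "y = numer i - denom i * \<xi>"
  have dpos: "real_of_int (denom i) ^ 3 > 0"
    using denom_ge[of i] by simp
  have rec: "numer (Suc i) - denom (Suc i) * \<xi> = real_of_int (denom i) ^ 3 * y - 1"
    by (simp add: denom_Suc y_def algebra_simps power_Suc2[symmetric] eval_nat_numeral)
  \<comment> \<open>The next error is thus below 1, and adding back the 1 of the recursion gives the
    constant 2 again.\<close>
  have "real_of_int (denom (Suc i)) ^ 3 \<ge> 2 ^ 3"
    using denom_ge[of "Suc i"] by (intro power_mono) auto
  then have "2 / real_of_int (denom (Suc i)) ^ 3 \<le> 1"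
    using denom_ge[of "Suc i"] by simp
  then have "0 < real_of_int (denom i) ^ 3 * y" "real_of_int (denom i) ^ 3 * y < 2"
    using step.IH unfolding rec by linarith+
  then show ?case
    using dpos unfolding y_def[symmetric]
    by (simp add: zero_less_mult_iff pos_less_divide_eq mult.commute)
qed

section \<open>Square roots of a residue class, modulo 1\<close>

text \<open>For large \<open>k\<close> the interval from (k + c)^2 to (k + d)^2 is longer than
  \<open>n\<close>, so it meets every residue class modulo \<open>n\<close>.\<close>

lemma sqrt_dense_mod_1:
  fixes m n :: int and c d :: real
  assumes "n > 0" "c < d"
  obtains D k :: int
  where "D \<ge> 2" "[D = m] (mod n)" "c < sqrt D - k" "sqrt D - k < d"
proof -
  \<comment> \<open>The term \<open>n / (d - c)\<close> makes the interval of squares long enough;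
    the others keep \<open>k + c\<close> and \<open>k + d\<close> at least 2.\<close>
  define k where "k = \<lceil>\<bar>c\<bar> + \<bar>d\<bar> + 2 + n / (d - c)\<rceil>"
  have k: "real_of_int k \<ge> \<bar>c\<bar> + \<bar>d\<bar> + 2 + n / (d - c)"
    unfolding k_def by linarith
  have npos: "n / (d - c) > 0"
    using assms by simp
  have kc: "k + c \<ge> 2" "k + d \<ge> 2"
    using k npos by linarith+
  \<comment> \<open>\<open>D\<close> is the least integer congruent to \<open>m\<close> strictly
    above (k + c)^2; taking \<open>f + 1\<close> instead of \<open>f\<close> gives
    strictness.\<close>
  define f where "f = \<lfloor>((k + c)\<^sup>2 - m) / n\<rfloor>"
  define D where "D = m + n * (f + 1)"
  have fl: "((k + c)\<^sup>2 - m) / n < f + 1" "f \<le> ((k + c)\<^sup>2 - m) / n"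
    unfolding f_def by linarith+
  have Dr: "real_of_int D = m + n * (f + 1)"
    by (simp add: D_def)
  have lo: "(k + c)\<^sup>2 < D"
    using fl(1) assms(1) unfolding Dr by (simp add: field_simps)
  have "D \<le> (k + c)\<^sup>2 + n"
    using fl(2) assms(1) unfolding Dr by (simp add: field_simps)
  moreover have "n < (k + d)\<^sup>2 - (k + c)\<^sup>2"
  proof -
    have "n / (d - c) < (k + c) + (k + d)"
      using k kc by linarith
    then have "n < ((k + c) + (k + d)) * (d - c)"
      using assms(2) by (simp add: pos_divide_less_eq)
    then show ?thesis
      by (simp add: power2_eq_square algebra_simps)
  qed
  ultimately have hi: "D < (k + d)\<^sup>2"
    by linarith
  show ?thesis
  proof
    have "(2::real)\<^sup>2 \<le> (k + c)\<^sup>2"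
      using kc by (intro power_mono) auto
    then show "D \<ge> 2"
      using lo by simp
    show "[D = m] (mod n)"
      by (simp add: D_def cong_def)
    show "c < sqrt D - k"
      using real_less_rsqrt[OF lo] by linarith
    show "sqrt D - k < d"
      using real_less_lsqrt[of "k + d" D] hi kc by linarith
  qed
qed

section \<open>Choice of \<open>D\<close> and of the elements to be represented\<close>

theorem theorem4p6:
  fixes m s n :: int
  assumes "n > 0"
  shows "\<exists>D::int. D \<ge> 2 \<and> \<not> is_square D \<and> [D = m] (mod n) \<and>
           (\<forall>r A. quadratic_form_over D r A \<and> universal_form D r A \<longrightarrow> int r \<ge> s)"
proof -
  \<comment> \<open>For negative \<open>s\<close> this is 0, and the bound is then trivial.\<close>
  define S where "S = nat s"
  define e where "e = 2 / real_of_int (denom S) ^ 3"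
  have dpos: "real_of_int (denom i) > 0" for i
    using denom_ge[of i] by simp
  then have "e > 0"
    by (simp add: e_def)
  \<comment> \<open>At these two ends for \<open>sqrt D - k\<close> the error of the last fraction
    would be \<open>e\<close> and 0.\<close>
  then have "(numer S - e) / denom S < numer S / denom S"
    using dpos[of S] by (simp add: divide_strict_right_mono)
  from sqrt_dense_mod_1[OF assms this, of m] obtain D k :: int
    where D: "D \<ge> 2" "[D = m] (mod n)"
      and \<xi>: "(numer S - e) / denom S < sqrt D - k" "sqrt D - k < numer S / denom S"
    by blast
  have "0 < numer S - denom S * (sqrt D - k)" "numer S - denom S * (sqrt D - k) < e"
    using \<xi> dpos[of S] by (simp_all add: field_simps)
  from approximation_descends[OF this[unfolded e_def]]
  have approx: "0 < numer i - denom i * (sqrt D - k)"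
    "numer i - denom i * (sqrt D - k) < 2 / real_of_int (denom i) ^ 3" if "i \<le> S" for i
    using that by blast+
  \<comment> \<open>Adding \<open>k\<close> to each fraction moves the approximation from
    \<open>sqrt D - k\<close> to \<open>sqrt D\<close> with the same error.\<close>
  define p where "p i = numer i + k * denom i" for i
  have p: "0 < p i - denom i * sqrt D" "p i - denom i * sqrt D < 2 / real_of_int (denom i) ^ 3" if "i \<le> S" for i
    using approx[OF that] by (simp_all add: p_def algebra_simps)
  have nsq: "\<not> is_square D"
  proof
    assume "is_square D"
    then obtain t where t: "D = t\<^sup>2"
      by (auto simp: is_nth_power_def)
    \<comment> \<open>Were sqrt D an integer, the error at index 0 would be an integer strictly
      between 0 and 1.\<close>
    have "0 < p 0 - denom 0 * \<bar>t\<bar>" "p 0 - denom 0 * \<bar>t\<bar> < 1"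
      using p[of 0] by (simp_all add: t denom_def)
    then show False
      by linarith
  qed
  have D0: "D \<ge> 0"
    using D by simp
  have \<theta>: "sqrt D \<ge> 1"
    using D by simp
  \<comment> \<open>The conjugate of \<open>\<alpha> i\<close> is the approximation error, which is
    positive because the fraction lies above \<open>sqrt D\<close>.\<close>
  define \<alpha> where "\<alpha> i = p i + denom i * sqrt D" for i
  have c\<alpha>: "conjugate D (\<alpha> i) = p i - denom i * sqrt D" for i
    unfolding \<alpha>_def by (rule conjugate_eq[OF D0 nsq])
  have tp: "totally_positive D (\<alpha> i)" if "i < S" for i
  proof -
    have "denom i * sqrt D > 0"
      using dpos[of i] D by simp
    then have "\<alpha> i > 0"
      using p[of i] that unfolding \<alpha>_def by linarith
    then show ?thesis
      using p[of i] that c\<alpha>[of i] Zsqrt_memI[of "p i" "denom i" D]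
      by (simp add: totally_positive_def \<alpha>_def)
  qed
  have sep: "\<beta> = 0" if ij: "i < j" "j < S" and "\<beta> \<in> Zsqrt D"
    and b: "\<beta>\<^sup>2 \<le> 4 * \<alpha> i * \<alpha> j"
    and b': "(conjugate D \<beta>)\<^sup>2 \<le> 4 * conjugate D (\<alpha> i) * conjugate D (\<alpha> j)" for i j \<beta>
  proof -
    from \<open>\<beta> \<in> Zsqrt D\<close> obtain a b :: int where \<beta>: "\<beta> = a + b * sqrt D"
      by (rule Zsqrt_memE)
    have "coprime (p j) (denom j)"
      using coprime_numer_denom[of j] unfolding p_def
      by (metis coprime_iff_gcd_eq_1 gcd_add_mult add.commute gcd.commute)
    then have "a = 0 \<and> b = 0"
      using p[of i] p[of j] ij \<theta> denom_ge[of i] denom_gap[OF ij(1)] b b'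
      unfolding \<beta> conjugate_eq[OF D0 nsq] c\<alpha> \<alpha>_def
      by (intro approximants_separated[of "sqrt D" "denom i" "denom j" "p j" "p i"]) auto
    then show ?thesis
      by (simp add: \<beta>)
  qed
  have "int r \<ge> s" if "quadratic_form_over D r A" "universal_form D r A" for r A
  proof -
    have "S \<le> r"
      by (rule universal_form_rank_ge[OF D0 nsq that tp sep])
    then show ?thesis
      by (simp add: S_def)
  qed
  then show ?thesis
    using D nsq by blast
qed

end
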